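(* Let $L$ be a set of lines and $P$ a set of points in $\mathbb{F}_q^3$. Then \[I(P,L)\leq (1+o(1))\left(|P||L|q^{-2}+q\sqrt{|P||L|(1-|P|q^{-3})(1-|L|q^{-4})}\right).\]
   Context: $\mathbb{F}_q$ is the finite field with $q$ elements; lines are one-dimensional affine subspaces of $\mathbb{F}_q^3$. For a set $P$ of points and a set $L$ of lines, $I(P,L)=|\{(p,\ell)\in P\times L : p\in\ell\}|$ is the number of incidences. Asymptotic notation is with respect to $q\to\infty$: $o(1)$ denotes a quantity tending to $0$ as $q\to\infty$ (independently of the choice of $P$ and $L$).
   Formalization: When |L| > q^4 the quantity under the square root can be negative (e.g. one point and all lines), so the root is undefined; the formal statement reads the root of a negative number as 0 and agrees with the stated bound whenever the root is defined. *)

theory Defs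
  imports Complex_Main "HOL-Algebra.Ring" "HOL-Algebra.Coset"
begin

text \<open>
  A bound in which \<open>o(1)\<close> is uniform over all finite fields has to quantify over fields inside the
  formula. Fields are therefore records with a carrier set, not instances of the type class.
\<close>

definition space3 :: "('a, 'm) ring_scheme \<Rightarrow> ('a \<times> 'a \<times> 'a) set" where
  "space3 F = carrier F \<times> carrier F \<times> carrier F"

definition add3 :: "('a, 'm) ring_scheme \<Rightarrow> 'a \<times> 'a \<times> 'a \<Rightarrow> 'a \<times> 'a \<times> 'a \<Rightarrow> 'a \<times> 'a \<times> 'a" where
  "add3 F = (\<lambda>(x, y, z) (x', y', z'). (x \<oplus>\<^bsub>F\<^esub> x', y \<oplus>\<^bsub>F\<^esub> y', z \<oplus>\<^bsub>F\<^esub> z'))"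

definition scale3 :: "('a, 'm) ring_scheme \<Rightarrow> 'a \<Rightarrow> 'a \<times> 'a \<times> 'a \<Rightarrow> 'a \<times> 'a \<times> 'a" where
  "scale3 F t = (\<lambda>(x, y, z). (t \<otimes>\<^bsub>F\<^esub> x, t \<otimes>\<^bsub>F\<^esub> y, t \<otimes>\<^bsub>F\<^esub> z))"

definition zero3 :: "('a, 'm) ring_scheme \<Rightarrow> 'a \<times> 'a \<times> 'a" where
  "zero3 F = (\<zero>\<^bsub>F\<^esub>, \<zero>\<^bsub>F\<^esub>, \<zero>\<^bsub>F\<^esub>)"

text \<open>
  The one-dimensional affine subspaces of \<open>F\<^sup>3\<close> are the translates of the linear spans of single
  nonzero vectors. A line is its point set, so different parametrisations of one line are identified.
\<close>

definition lines3 :: "('a, 'm) ring_scheme \<Rightarrow> ('a \<times> 'a \<times> 'a) set set" where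
  "lines3 F = {{add3 F a (scale3 F t v) | t. t \<in> carrier F} | a v.
     a \<in> space3 F \<and> v \<in> space3 F \<and> v \<noteq> zero3 F}"

definition incidences :: "'p set \<Rightarrow> 'p set set \<Rightarrow> nat" where
  "incidences P L = card {(p, l) \<in> P \<times> L. p \<in> l}"

text \<open>
  There are \<open>q\<^sup>4 + q\<^sup>3 + q\<^sup>2\<close> lines in \<open>F\<^sup>3\<close>, so \<open>1 - l / q\<^sup>4\<close> is negative for some sets of
  \<open>l\<close> lines, and then the radicand below may be negative. The root of a negative radicand is read
  as 0. Without this truncation the bound fails for one point and all lines, since HOL's
  \<open>sqrt\<close> is odd. The truncation has no effect when the radicand is nonnegative, in particular when
  \<open>l \<le> q\<^sup>4\<close> (and \<open>p \<le> q\<^sup>3\<close>, which always holds for sets of points).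
\<close>

definition incidence_bound :: "real \<Rightarrow> real \<Rightarrow> real \<Rightarrow> real" where
  "incidence_bound q p l =
     p * l / q ^ 2 + q * sqrt (max 0 (p * l * (1 - p / q ^ 3) * (1 - l / q ^ 4)))"

end

theory Submission
  imports "HOL-Analysis.Convex" "HOL-Real_Asymp.Real_Asymp" Defs
begin

text \<open>
  The lines of \<open>F\<^sup>3\<close> form a Steiner system \<open>S(2, q, q\<^sup>3)\<close>. In a Steiner system the variance over all
  blocks of the number of points of \<open>P\<close> on a block can be computed exactly, and Cauchy--Schwarz on
  \<open>L\<close> and on its complement gives the bound with \<open>q\<^sup>2 + q\<close> in place of \<open>q\<^sup>2\<close> and with
  the number \<open>q\<^sup>4 + q\<^sup>3 + q\<^sup>2\<close> of all lines in place of \<open>q\<^sup>4\<close>. The latter replacement costs only a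
  factor \<open>1 + o(1)\<close> as long as \<open>|L| \<le> q\<^sup>4 (1 - 1 / sqrt q)\<close>. For larger \<open>L\<close> the main term
  \<open>|P| |L| / q\<^sup>2\<close> alone is asymptotically as large as the trivial bound \<open>|P| (q\<^sup>2 + q + 1)\<close>.
\<close>

section \<open>Incidences in Steiner systems\<close>

lemma sum_inter_card_eq:
  assumes "finite P" "finite L"
  shows "(\<Sum>l\<in>L. card (P \<inter> l)) = (\<Sum>x\<in>P. card {l \<in> L. x \<in> l})"
proof -
  have "(\<Sum>l\<in>L. card (P \<inter> l)) = (\<Sum>l\<in>L. \<Sum>x\<in>P. if x \<in> l then 1 else 0)"
    using assms by (simp add: sum.If_cases Int_def)
  also have "\<dots> = (\<Sum>x\<in>P. \<Sum>l\<in>L. if x \<in> l then 1 else 0)"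
    by (rule sum.swap)
  also have "\<dots> = (\<Sum>x\<in>P. card {l \<in> L. x \<in> l})"
    using assms by (simp add: sum.If_cases Int_def)
  finally show ?thesis .
qed

text \<open>The sums over \<open>S\<close> and \<open>A - S\<close> have the same square, and
  Cauchy-Schwarz bounds it on either side. Weighting the bound for \<open>S\<close> by
  \<open>a - s\<close> and the one for \<open>A - S\<close> by \<open>s\<close>, then adding, yields
  the factor \<open>1 - s / a\<close>, which later becomes the density factor of
  \<open>L\<close>.\<close>

lemma square_sum_le_if_sum_eq_0:
  fixes f :: "'b \<Rightarrow> real"
  assumes "finite A" "S \<subseteq> A" "sum f A = 0"
  shows "(sum f S)\<^sup>2 \<le> real (card S) * (1 - real (card S) / real (card A)) * (\<Sum>x\<in>A. (f x)\<^sup>2)"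
proof (cases "A = {}")
  case True
  then show ?thesis using assms by auto
next
  case False
  define a s where "a = real (card A)" and "s = real (card S)"
  have a: "a > 0" using False assms(1) by (simp add: a_def card_gt_0_iff)
  have fS: "finite S" using assms finite_subset by blast
  have d: "real (card (A - S)) = a - s"
    using assms fS by (simp add: a_def s_def card_Diff_subset card_mono of_nat_diff)
  have split: "sum g A = sum g S + sum g (A - S)" for g :: "'b \<Rightarrow> real"
    using sum.subset_diff[OF assms(2,1), of g] by simp
  have "s * (sum f S)\<^sup>2 = s * (sum f (A - S))\<^sup>2"
    using split[of f] assms(3) by (simp add: eq_neg_iff_add_eq_0[symmetric])
  also have "\<dots> \<le> s * ((a - s) * (\<Sum>x\<in>A - S. (f x)\<^sup>2))"
    using sum_squared_le_sum_of_squares[of f "A - S"] d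
    by (intro mult_left_mono) (auto simp: s_def mult.commute)
  finally have 1: "s * (sum f S)\<^sup>2 \<le> s * ((a - s) * (\<Sum>x\<in>A - S. (f x)\<^sup>2))" .
  have "(a - s) * (sum f S)\<^sup>2 \<le> (a - s) * (s * (\<Sum>x\<in>S. (f x)\<^sup>2))"
    using sum_squared_le_sum_of_squares[of f S] d[symmetric]
    by (intro mult_left_mono) (auto simp: s_def mult.commute)
  with 1 have "a * (sum f S)\<^sup>2 \<le> s * (a - s) * (\<Sum>x\<in>A. (f x)\<^sup>2)"
    unfolding split by (simp add: algebra_simps)
  then show ?thesis
    using a unfolding a_def[symmetric] s_def[symmetric] by (simp add: field_simps)
qed

locale steiner_system =
  fixes X :: "'p set" and B :: "'p set set" and k :: nat
  assumes finite_X: "finite X"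
    and block_subset: "\<And>l. l \<in> B \<Longrightarrow> l \<subseteq> X"
    and card_block: "\<And>l. l \<in> B \<Longrightarrow> card l = k"
    and ex1_block: "\<And>x y. x \<in> X \<Longrightarrow> y \<in> X \<Longrightarrow> x \<noteq> y \<Longrightarrow> \<exists>!l. l \<in> B \<and> x \<in> l \<and> y \<in> l"
    and k_gt_1: "k > 1"
    and X_nonempty: "X \<noteq> {}"
begin

section \<open>Parameters of a Steiner system and moments of block intersections\<close>

lemma finite_B: "finite B"
  by (rule finite_subset[of _ "Pow X"]) (use block_subset finite_X in auto)

text \<open>The blocks through \<open>x\<close>, with \<open>x\<close> removed, partition
  \<open>X - {x}\<close> into sets of size \<open>k - 1\<close>.\<close>

lemma degree_eq:
  assumes "x \<in> X"
  shows "card {l \<in> B. x \<in> l} * (k - 1) = card X - 1"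
proof -
  have "X - {x} = (\<Union>l\<in>{l \<in> B. x \<in> l}. l - {x})"
    using ex1_block[OF assms] block_subset by fast
  also have "card \<dots> = (\<Sum>l\<in>{l \<in> B. x \<in> l}. card (l - {x}))"
  proof (rule card_UN_disjoint)
    show "\<forall>l\<in>{l \<in> B. x \<in> l}. finite (l - {x})"
      using block_subset finite_X by (blast intro: finite_subset)
    show "\<forall>l\<in>{l \<in> B. x \<in> l}. \<forall>m\<in>{l \<in> B. x \<in> l}. l \<noteq> m \<longrightarrow> (l - {x}) \<inter> (m - {x}) = {}"
      using ex1_block[OF assms] block_subset by blast
  qed (use finite_B in simp)
  also have "\<dots> = (\<Sum>l\<in>{l \<in> B. x \<in> l}. k - 1)"
    by (rule sum.cong) (auto simp: card_block)
  finally show ?thesis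
    using assms by simp
qed

text \<open>The replication number. By \<open>degree_eq\<close> the division is exact, and the
  formula shows that it is the same at every point.\<close>

definition r :: nat where "r = (card X - 1) div (k - 1)"

lemma degree: "x \<in> X \<Longrightarrow> card {l \<in> B. x \<in> l} = r"
  using degree_eq[of x] k_gt_1 unfolding r_def
  by (metis nonzero_mult_div_cancel_right zero_less_diff less_numeral_extra(3))

lemma r_mult: "real r * (real k - 1) = real (card X) - 1"
proof -
  obtain x where x: "x \<in> X" using X_nonempty by blast
  then have "card X \<ge> 1" using finite_X card_gt_0_iff[of X] by (auto simp: Suc_le_eq)
  moreover have "real (r * (k - 1)) = real (card X - 1)"
    using degree_eq[OF x] degree[OF x] by simp
  ultimately show ?thesis using k_gt_1 by (simp add: of_nat_diff)
qed

lemma sum_inter_card: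
  assumes "P \<subseteq> X"
  shows "(\<Sum>l\<in>B. card (P \<inter> l)) = card P * r"
  using assms finite_B finite_X degree
  by (subst sum_inter_card_eq) (auto simp: subset_iff intro: finite_subset)

text \<open>Incidences of all points with all blocks, counted in two ways.\<close>

lemma card_B_mult: "card B * k = card X * r"
proof -
  have "(\<Sum>l\<in>B. card (X \<inter> l)) = (\<Sum>l\<in>B. k)"
    using block_subset card_block by (intro sum.cong) (auto simp: Int_absorb1)
  then show ?thesis using sum_inter_card[of X] by simp
qed

text \<open>Count triples of a block and two points of \<open>P\<close> on it: each of the
  \<open>card P\<close> pairs with equal entries lies on \<open>r\<close> blocks, every other
  ordered pair on exactly one.\<close>

lemma sum_inter_card_square:
  assumes "P \<subseteq> X"
  shows "(\<Sum>l\<in>B. (real (card (P \<inter> l)))\<^sup>2) = real (card P) * (real r - 1) + (real (card P))\<^sup>2"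
proof -
  have fP: "finite P" using assms finite_X finite_subset by blast
  have inner: "(\<Sum>l\<in>{l \<in> B. x \<in> l}. card (P \<inter> l)) = r + card P - 1" if x: "x \<in> P" for x
  proof -
    have "(\<Sum>l\<in>{l \<in> B. x \<in> l}. card (P \<inter> l)) = (\<Sum>y\<in>P. card {l \<in> {l \<in> B. x \<in> l}. y \<in> l})"
      using fP finite_B by (intro sum_inter_card_eq) auto
    also have "\<dots> = (\<Sum>y\<in>P. if y = x then r else 1)"
    proof (rule sum.cong[OF refl])
      fix y assume y: "y \<in> P"
      show "card {l \<in> {l \<in> B. x \<in> l}. y \<in> l} = (if y = x then r else 1)"
      proof (cases "y = x")
        case True
        then show ?thesis using degree[of x] x assms by (auto simp: conj_ac)
      next
        case False
        obtain m where "m \<in> B" "x \<in> m" "y \<in> m" "\<And>l. l \<in> B \<Longrightarrow> x \<in> l \<Longrightarrow> y \<in> l \<Longrightarrow> l = m"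
          using ex1_block[of x y] x y assms False by blast
        then have "{l \<in> {l \<in> B. x \<in> l}. y \<in> l} = {m}" by blast
        then show ?thesis using False by simp
      qed
    qed
    also have "\<dots> = r + card (P - {x})"
      using x fP by (simp add: sum.remove[of P x])
    also have "\<dots> = r + card P - 1"
      using x fP card_gt_0_iff[of P] by (auto simp: Suc_le_eq)
    finally show ?thesis .
  qed
  \<comment> \<open>One factor of the square is expanded over the points of \<open>P\<close> on
    \<open>l\<close>; swapping the sums then leaves \<open>inner\<close> for each point.\<close>
  have "(\<Sum>l\<in>B. (real (card (P \<inter> l)))\<^sup>2)
      = (\<Sum>l\<in>B. \<Sum>x\<in>P. if x \<in> l then real (card (P \<inter> l)) else 0)"
    using fP by (simp add: sum.If_cases Int_def power2_eq_square)
  also have "\<dots> = (\<Sum>x\<in>P. \<Sum>l\<in>B. if x \<in> l then real (card (P \<inter> l)) else 0)"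
    by (rule sum.swap)
  also have "\<dots> = (\<Sum>x\<in>P. real (\<Sum>l\<in>{l \<in> B. x \<in> l}. card (P \<inter> l)))"
    using finite_B by (simp add: sum.If_cases Int_def)
  also have "\<dots> = (\<Sum>x\<in>P. real r + real (card P) - 1)"
  proof (rule sum.cong[OF refl])
    fix x assume "x \<in> P"
    moreover from this have "card P \<ge> 1" using fP card_gt_0_iff[of P] by (auto simp: Suc_le_eq)
    ultimately show "real (\<Sum>l\<in>{l \<in> B. x \<in> l}. card (P \<inter> l)) = real r + real (card P) - 1"
      by (simp add: inner of_nat_diff)
  qed
  finally show ?thesis by (simp add: algebra_simps power2_eq_square)
qed

section \<open>Incidence counts, variance and the mixing inequality\<close>

lemma incidences_eq_sum:
  assumes "P \<subseteq> X" "L \<subseteq> B"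
  shows "incidences P L = (\<Sum>l\<in>L. card (P \<inter> l))"
proof -
  have fP: "finite P" and fL: "finite L"
    using assms finite_X finite_B finite_subset by blast+
  have "{(p, l) \<in> P \<times> L. p \<in> l} = prod.swap ` (SIGMA l:L. P \<inter> l)" by force
  then show ?thesis
    unfolding incidences_def using fP fL by (simp add: card_image)
qed

text \<open>The trivial bound, which takes over when \<open>L\<close> contains almost all
  blocks.\<close>

lemma incidences_le:
  assumes "P \<subseteq> X" "L \<subseteq> B"
  shows "incidences P L \<le> card P * r"
  unfolding incidences_eq_sum[OF assms] sum_inter_card[OF assms(1), symmetric]
  using assms finite_B by (intro sum_mono2) auto

lemma card_X_pos: "real (card X) > 0"
  using X_nonempty finite_X by (simp add: card_gt_0_iff)

text \<open>\<open>\<mu>\<close> is the mean of \<open>card (P \<inter> l)\<close> over all blocks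
  by \<open>card_B_mult\<close>, so the deviations cancel. The variance comes from the first two
  moments.\<close>

lemma variance_inter_card:
  assumes "P \<subseteq> X"
  defines "\<mu> \<equiv> real (card P) * real k / real (card X)"
  shows "(\<Sum>l\<in>B. (real (card (P \<inter> l)) - \<mu>)\<^sup>2)
    = (real r - 1) * real (card P) * (1 - real (card P) / real (card X))"
    and "(\<Sum>l\<in>B. real (card (P \<inter> l)) - \<mu>) = 0"
proof -
  have v: "real (card X) > 0" by (rule card_X_pos)
  have bk: "real (card B) * real k = real (card X) * real r"
    using card_B_mult by (metis of_nat_mult)
  have s1: "(\<Sum>l\<in>B. real (card (P \<inter> l))) = real (card P) * real r"
    using sum_inter_card[OF assms(1)] by (metis of_nat_mult of_nat_sum)
  have b\<mu>: "real (card B) * \<mu> = real (card P) * real r"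
    unfolding \<mu>_def using v bk by (simp add: field_simps)
  show "(\<Sum>l\<in>B. real (card (P \<inter> l)) - \<mu>) = 0"
    by (simp add: sum_subtractf s1 b\<mu>)
  have "(\<Sum>l\<in>B. (real (card (P \<inter> l)) - \<mu>)\<^sup>2)
      = (\<Sum>l\<in>B. (real (card (P \<inter> l)))\<^sup>2) - 2 * \<mu> * (\<Sum>l\<in>B. real (card (P \<inter> l))) + real (card B) * \<mu> * \<mu>"
    by (simp add: power2_diff sum.distrib sum_subtractf sum_distrib_left algebra_simps power2_eq_square)
  also have "\<dots> = real (card P) * (real r - 1) + (real (card P))\<^sup>2 - \<mu> * (real (card P) * real r)"
    unfolding sum_inter_card_square[OF assms(1)] s1 b\<mu> by (simp add: algebra_simps)
  also have "\<mu> * (real (card P) * real r) = (real (card P))\<^sup>2 * (real r * real k) / real (card X)"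
    unfolding \<mu>_def by (simp add: power2_eq_square)
  \<comment> \<open>This form of \<open>r_mult\<close> makes \<open>r - 1\<close> a common factor of
    the remaining terms.\<close>
  also have "real r * real k = real r + real (card X) - 1"
    using r_mult by (simp add: algebra_simps)
  finally show "(\<Sum>l\<in>B. (real (card (P \<inter> l)) - \<mu>)\<^sup>2)
    = (real r - 1) * real (card P) * (1 - real (card P) / real (card X))"
    using v by (simp add: field_simps power2_eq_square)
qed

text \<open>The incidences are \<open>\<mu> * card L\<close> plus the deviations summed over
  \<open>L\<close>; \<open>square_sum_le_if_sum_eq_0\<close> bounds this sum through the variance
  over all blocks.\<close>

lemma expander_mixing:
  assumes "P \<subseteq> X" "L \<subseteq> B"
  shows "real (incidences P L) \<le> real (card P) * real (card L) * real k / real (card X)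
    + sqrt ((real r - 1) * (real (card P) * real (card L)
        * (1 - real (card P) / real (card X)) * (1 - real (card L) / real (card B))))"
proof -
  define \<mu> where "\<mu> = real (card P) * real k / real (card X)"
  let ?S = "\<Sum>l\<in>L. real (card (P \<inter> l)) - \<mu>"
  have "?S\<^sup>2 \<le> real (card L) * (1 - real (card L) / real (card B))
      * (\<Sum>l\<in>B. (real (card (P \<inter> l)) - \<mu>)\<^sup>2)"
    using variance_inter_card(2)[OF assms(1)] assms(2) finite_B unfolding \<mu>_def
    by (intro square_sum_le_if_sum_eq_0)
  also have "\<dots> = (real r - 1) * (real (card P) * real (card L)
        * (1 - real (card P) / real (card X)) * (1 - real (card L) / real (card B)))"
    unfolding \<mu>_def variance_inter_card(1)[OF assms(1)] by simp
  finally have "?S \<le> sqrt \<dots>" by (rule real_le_rsqrt)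
  moreover have "?S = real (incidences P L) - real (card L) * \<mu>"
    by (simp add: incidences_eq_sum[OF assms] sum_subtractf)
  ultimately show ?thesis by (simp add: \<mu>_def algebra_simps)
qed

end

section \<open>Lines in three-dimensional space\<close>

context field
begin

lemma card_line3:
  assumes "l \<in> lines3 R"
  shows "card l = order R" and "l \<subseteq> space3 R"
proof -
  obtain a v where l: "l = (\<lambda>t. add3 R a (scale3 R t v)) ` carrier R"
    and a: "a \<in> space3 R" and v: "v \<in> space3 R" "v \<noteq> zero3 R"
    using assms unfolding lines3_def by blast
  obtain a1 a2 a3 v1 v2 v3 where eq: "a = (a1, a2, a3)" "v = (v1, v2, v3)"
    by (metis prod_cases3)
  have carr: "a1 \<in> carrier R" "a2 \<in> carrier R" "a3 \<in> carrier R"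
    "v1 \<in> carrier R" "v2 \<in> carrier R" "v3 \<in> carrier R"
    and nz: "v1 \<noteq> \<zero> \<or> v2 \<noteq> \<zero> \<or> v3 \<noteq> \<zero>"
    using a v by (auto simp: space3_def zero3_def eq)
  \<comment> \<open>Some coordinate of \<open>v\<close> is nonzero and can be cancelled.\<close>
  have "inj_on (\<lambda>t. add3 R a (scale3 R t v)) (carrier R)"
    by (rule inj_onI) (use carr nz in \<open>auto simp: add3_def scale3_def eq m_rcancel\<close>)
  then show "card l = order R" by (simp add: l card_image order_def)
  show "l \<subseteq> space3 R" using carr by (auto simp: l add3_def scale3_def space3_def eq)
qed

text \<open>The line through \<open>x\<close> with direction \<open>y - x\<close>, the difference
  being built from \<open>add3\<close> and \<open>scale3\<close>. The parameters 0 and 1 give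
  \<open>x\<close> and \<open>y\<close>.\<close>

definition join3 :: "'a \<times> 'a \<times> 'a \<Rightarrow> 'a \<times> 'a \<times> 'a \<Rightarrow> ('a \<times> 'a \<times> 'a) set" where
  "join3 x y = {add3 R x (scale3 R t (add3 R y (scale3 R (\<ominus> \<one>) x))) | t. t \<in> carrier R}"

lemma join3:
  assumes "x \<in> space3 R" "y \<in> space3 R" "x \<noteq> y"
  shows "join3 x y \<in> lines3 R" and "x \<in> join3 x y" and "y \<in> join3 x y"
proof -
  obtain x1 x2 x3 y1 y2 y3 where eq: "x = (x1, x2, x3)" "y = (y1, y2, y3)"
    by (metis prod_cases3)
  have carr: "x1 \<in> carrier R" "x2 \<in> carrier R" "x3 \<in> carrier R"
    "y1 \<in> carrier R" "y2 \<in> carrier R" "y3 \<in> carrier R"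
    using assms by (auto simp: space3_def eq)
  have eqI: "a = b" if "b \<oplus> (\<ominus> \<one>) \<otimes> a = \<zero>" "a \<in> carrier R" "b \<in> carrier R" for a b
  proof -
    have "(\<ominus> \<one>) \<otimes> a = \<ominus> a" using that by (simp add: l_minus)
    then have "\<ominus> (\<ominus> a) = b" using that by (intro minus_equality) simp_all
    then show ?thesis using that by simp
  qed
  have "add3 R y (scale3 R (\<ominus> \<one>) x) \<noteq> zero3 R"
    using assms(3) carr eqI[of y1 x1] eqI[of y2 x2] eqI[of y3 x3]
    by (auto simp: add3_def scale3_def zero3_def eq)
  moreover have "add3 R y (scale3 R (\<ominus> \<one>) x) \<in> space3 R"
    using carr by (auto simp: add3_def scale3_def space3_def eq)
  ultimately show "join3 x y \<in> lines3 R"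
    using assms(1) unfolding join3_def lines3_def by blast
  have "x = add3 R x (scale3 R \<zero> (add3 R y (scale3 R (\<ominus> \<one>) x)))"
    using carr by (simp add: add3_def scale3_def eq)
  then show "x \<in> join3 x y" unfolding join3_def by blast
  have "a \<oplus> \<one> \<otimes> (b \<oplus> (\<ominus> \<one>) \<otimes> a) = b" if "a \<in> carrier R" "b \<in> carrier R" for a b
    using that by algebra
  then have "y = add3 R x (scale3 R \<one> (add3 R y (scale3 R (\<ominus> \<one>) x)))"
    using carr by (simp add: add3_def scale3_def eq del: l_one)
  then show "y \<in> join3 x y" unfolding join3_def by blast
qed

text \<open>One inclusion suffices, since all lines have the same finite number of points. This
  avoids inverting the difference of the parameters of \<open>x\<close> and
  \<open>y\<close>.\<close>

lemma line3_eq_join3: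
  assumes "finite (carrier R)" "l \<in> lines3 R" "x \<in> l" "y \<in> l" "x \<noteq> y"
  shows "l = join3 x y"
proof -
  obtain a v where l: "l = {add3 R a (scale3 R t v) | t. t \<in> carrier R}"
    and a: "a \<in> space3 R" and v: "v \<in> space3 R"
    using assms(2) unfolding lines3_def by blast
  obtain a1 a2 a3 v1 v2 v3 where eq: "a = (a1, a2, a3)" "v = (v1, v2, v3)"
    by (metis prod_cases3)
  have carr: "a1 \<in> carrier R" "a2 \<in> carrier R" "a3 \<in> carrier R"
    "v1 \<in> carrier R" "v2 \<in> carrier R" "v3 \<in> carrier R"
    using a v by (auto simp: space3_def eq)
  obtain s t where st: "s \<in> carrier R" "t \<in> carrier R"
    and x: "x = add3 R a (scale3 R s v)" and y: "y = add3 R a (scale3 R t v)"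
    using assms(3,4) l by blast
  \<comment> \<open>In each coordinate, the point at parameter \<open>u\<close> of the join of the
    points at \<open>s\<close> and \<open>t\<close> is the point of \<open>l\<close> at parameter
    \<open>s + u (t - s)\<close>.\<close>
  have coord: "(c \<oplus> s \<otimes> w) \<oplus> u \<otimes> ((c \<oplus> t \<otimes> w) \<oplus> (\<ominus> \<one>) \<otimes> (c \<oplus> s \<otimes> w))
      = c \<oplus> (s \<oplus> u \<otimes> (t \<oplus> \<ominus> s)) \<otimes> w"
    if "c \<in> carrier R" "w \<in> carrier R" "u \<in> carrier R" for c w u
    using that st by algebra
  have "join3 x y \<subseteq> l"
  proof
    fix z assume "z \<in> join3 x y"
    then obtain u where u: "u \<in> carrier R"
      and z: "z = add3 R x (scale3 R u (add3 R y (scale3 R (\<ominus> \<one>) x)))"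
      unfolding join3_def by blast
    have "z = add3 R a (scale3 R (s \<oplus> u \<otimes> (t \<oplus> \<ominus> s)) v)"
      using carr u by (simp add: z x y add3_def scale3_def eq coord)
    moreover have "s \<oplus> u \<otimes> (t \<oplus> \<ominus> s) \<in> carrier R" using st u by simp
    ultimately show "z \<in> l" unfolding l by blast
  qed
  moreover have "x \<in> space3 R" "y \<in> space3 R" using card_line3(2) assms by blast+
  then have "card (join3 x y) = card l"
    using card_line3(1) join3(1) assms by simp
  moreover have "finite l" unfolding l using assms(1) by simp
  ultimately show ?thesis using card_subset_eq by metis
qed

lemma card_space3: "card (space3 R) = order R ^ 3"
  by (simp add: space3_def order_def card_cartesian_product power3_eq_cube)

lemma order_gt_1: "finite (carrier R) \<Longrightarrow> order R > 1"
  unfolding order_def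
  using card_mono[of "carrier R" "{\<zero>, \<one>}"] zero_not_one by simp

lemma steiner_system_lines3:
  assumes "finite (carrier R)"
  shows "steiner_system (space3 R) (lines3 R) (order R)"
proof
  show "finite (space3 R)" using assms by (simp add: space3_def)
  show "l \<subseteq> space3 R" "card l = order R" if "l \<in> lines3 R" for l
    using card_line3 that by blast+
  show "\<exists>!l. l \<in> lines3 R \<and> x \<in> l \<and> y \<in> l" if "x \<in> space3 R" "y \<in> space3 R" "x \<noteq> y" for x y
    using join3[OF that] line3_eq_join3[OF assms _ _ _ that(3)] by blast
  show "order R > 1" using order_gt_1 assms by blast
  show "space3 R \<noteq> {}" by (auto simp: space3_def)
qed

end

section \<open>Comparison of the bounds\<close>

text \<open>Put \<open>\<delta> = 1 - l / q ^ 4\<close>. Passing from \<open>q ^ 4\<close> to the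
  number of all lines raises \<open>\<delta>\<close> by at most \<open>2 / q\<close>. The hypothesis
  \<open>small\<close> says \<open>\<delta> \<ge> 1 / sqrt q\<close>, so this is a relative error of
  at most \<open>2 / sqrt q\<close>.\<close>

lemma max_0_radicand_le:
  fixes q p l c :: real
  assumes q: "q > 1" and p: "0 \<le> p" "p \<le> q ^ 3" and l: "0 \<le> l"
    and small: "l \<le> q ^ 4 * (1 - 1 / sqrt q)"
  shows "(q\<^sup>2 + q) * (p * l * (1 - p / q ^ 3) * (1 - l / (q ^ 4 + q ^ 3 + q\<^sup>2)))
    \<le> ((1 + 1 / q) * (1 + 2 / sqrt q) * q)\<^sup>2 * max 0 (p * l * (1 - p / q ^ 3) * (1 - l / q ^ 4))"
proof -
  define \<delta> where "\<delta> = 1 - l / q ^ 4"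
  have leq: "l = q ^ 4 * (1 - \<delta>)" using q by (simp add: \<delta>_def)
  have \<delta>_ge: "1 / sqrt q \<le> \<delta>" using small q by (simp add: leq)
  moreover have "0 \<le> 1 / sqrt q" using q by simp
  ultimately have \<delta>0: "0 \<le> \<delta>" by linarith
  have "1 / q = 1 / sqrt q / sqrt q" using q by simp
  also have "\<dots> \<le> \<delta> / sqrt q" using \<delta>_ge q by (intro divide_right_mono) auto
  finally have \<delta>: "1 / q \<le> \<delta> / sqrt q" "0 \<le> \<delta>" using \<delta>0 by auto
  have \<delta>1: "\<delta> \<le> 1" using l q by (simp add: \<delta>_def)
  have "l / (q ^ 4 + q ^ 3 + q\<^sup>2) = (1 - \<delta>) / (1 + 1 / q + 1 / q\<^sup>2)"
  proof -
    have "q ^ 4 + q ^ 3 + q\<^sup>2 = q ^ 4 * (1 + 1 / q + 1 / q\<^sup>2)"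
      using q by (simp add: field_simps power2_eq_square power3_eq_cube power4_eq_xxxx)
    then show ?thesis unfolding leq using q by simp
  qed
  moreover have "1 / (1 + 1 / q + 1 / q\<^sup>2) \<ge> 1 - 2 / q"
  proof -
    have "1 / q\<^sup>2 \<le> 1 / q" using q by (simp add: field_simps power2_eq_square)
    then have "1 / (1 + 1 / q + 1 / q\<^sup>2) \<ge> 1 / (1 + 2 / q)"
      using q by (intro divide_left_mono) (auto simp: add_pos_pos intro!: mult_pos_pos)
    moreover have "1 / (1 + 2 / q) \<ge> 1 - 2 / q" using q by (simp add: field_simps)
    ultimately show ?thesis by linarith
  qed
  then have "(1 - \<delta>) * (1 - 2 / q) \<le> (1 - \<delta>) * (1 / (1 + 1 / q + 1 / q\<^sup>2))"
    using \<delta>1 by (intro mult_left_mono) auto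
  moreover have "(1 - \<delta>) * (2 / q) \<le> 2 / q"
    using \<delta> q by (intro mult_left_le_one_le) (auto simp: \<delta>1)
  ultimately have "1 - l / (q ^ 4 + q ^ 3 + q\<^sup>2) \<le> \<delta> + 2 / q"
    by (simp add: algebra_simps)
  also have "\<dots> \<le> (1 + 2 / sqrt q) * \<delta>" using mult_left_mono[OF \<delta>(1), of 2] by (simp add: algebra_simps)
  \<comment> \<open>Squaring a factor that is at least 1 weakens the bound, but lets the factor
    leave the square root cleanly.\<close>
  also have "\<dots> \<le> (1 + 2 / sqrt q)\<^sup>2 * \<delta>"
    using \<delta> q by (intro mult_right_mono self_le_power) auto
  finally have A: "1 - l / (q ^ 4 + q ^ 3 + q\<^sup>2) \<le> (1 + 2 / sqrt q)\<^sup>2 * \<delta>" .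
  have "q\<^sup>2 + q = q\<^sup>2 * (1 + 1 / q)" using q by (simp add: field_simps power2_eq_square)
  also have "\<dots> \<le> q\<^sup>2 * (1 + 1 / q)\<^sup>2"
    using q by (intro mult_left_mono self_le_power) auto
  finally have C: "q\<^sup>2 + q \<le> q\<^sup>2 * (1 + 1 / q)\<^sup>2" .
  have D: "0 \<le> p * l * (1 - p / q ^ 3)" using p l q by (intro mult_nonneg_nonneg) auto
  have "(q\<^sup>2 + q) * (p * l * (1 - p / q ^ 3) * (1 - l / (q ^ 4 + q ^ 3 + q\<^sup>2)))
      \<le> (q\<^sup>2 + q) * (p * l * (1 - p / q ^ 3) * ((1 + 2 / sqrt q)\<^sup>2 * \<delta>))"
    using A D q by (intro mult_left_mono) auto
  also have "\<dots> \<le> q\<^sup>2 * (1 + 1 / q)\<^sup>2 * (p * l * (1 - p / q ^ 3) * ((1 + 2 / sqrt q)\<^sup>2 * \<delta>))"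
    using C D \<delta> by (intro mult_right_mono mult_nonneg_nonneg[OF D]) auto
  also have "\<dots> = ((1 + 1 / q) * (1 + 2 / sqrt q) * q)\<^sup>2 * (p * l * (1 - p / q ^ 3) * \<delta>)"
    by (simp add: power_mult_distrib)
  finally show ?thesis
    using D \<delta> by (simp add: \<delta>_def max_def mult_nonneg_nonneg)
qed

text \<open>The hypothesis \<open>mix\<close> serves small \<open>l\<close> and \<open>triv\<close>
  serves large \<open>l\<close>. The loss \<open>1 + 2 / sqrt q\<close> comes from comparing
  radicands, \<open>1 + 1 / q + 1 / q\<^sup>2\<close> from the degree divided by
  \<open>q\<^sup>2\<close>, and \<open>1 / (1 - 1 / sqrt q)\<close> from the threshold on
  \<open>l\<close>.\<close>

lemma le_incidence_bound:
  fixes q p l i :: real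
  assumes q: "q > 1" and p: "0 \<le> p" "p \<le> q ^ 3" and l: "0 \<le> l"
    and triv: "i \<le> p * (q\<^sup>2 + q + 1)"
    and mix: "i \<le> p * l * q / q ^ 3
      + sqrt ((q\<^sup>2 + q) * (p * l * (1 - p / q ^ 3) * (1 - l / (q ^ 4 + q ^ 3 + q\<^sup>2))))"
  shows "i \<le> (1 + 1 / q + 1 / q\<^sup>2) * (1 + 2 / sqrt q) / (1 - 1 / sqrt q) * incidence_bound q p l"
proof -
  define M where "M = (1 + 1 / q + 1 / q\<^sup>2) * (1 + 2 / sqrt q) / (1 - 1 / sqrt q)"
  define m where "m = max 0 (p * l * (1 - p / q ^ 3) * (1 - l / q ^ 4))"
  have sq: "0 < 1 - 1 / sqrt q" "1 - 1 / sqrt q \<le> 1" using q by auto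
  have ge1: "1 + 2 / sqrt q \<ge> 1" "1 + 1 / q \<ge> 1" "1 + 1 / q + 1 / q\<^sup>2 \<ge> 1 + 1 / q" using q by auto
  \<comment> \<open>The single constant \<open>M\<close> dominates the losses of both cases:
    \<open>M0\<close> and \<open>M1\<close> are for small \<open>l\<close>, \<open>M2\<close> is for
    large \<open>l\<close>.\<close>
  have "(1 + 1 / q) * (1 + 2 / sqrt q) \<le> (1 + 1 / q + 1 / q\<^sup>2) * (1 + 2 / sqrt q)"
    using ge1 by (intro mult_right_mono) auto
  also have "\<dots> \<le> M"
    unfolding M_def le_divide_eq
    using sq ge1 by (simp only: if_True) (intro mult_right_le_one_le mult_nonneg_nonneg; linarith)
  finally have M1: "(1 + 1 / q) * (1 + 2 / sqrt q) \<le> M" .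
  moreover have "1 * 1 \<le> (1 + 1 / q) * (1 + 2 / sqrt q)" using ge1 by (intro mult_mono) auto
  ultimately have M0: "1 \<le> M" by linarith
  have "(1 + 1 / q + 1 / q\<^sup>2) * 1 \<le> (1 + 1 / q + 1 / q\<^sup>2) * (1 + 2 / sqrt q)"
    using ge1 by (intro mult_left_mono; linarith)
  then have M2: "(1 + 1 / q + 1 / q\<^sup>2) / (1 - 1 / sqrt q) \<le> M"
    unfolding M_def using sq by (intro divide_right_mono) auto
  have m0: "0 \<le> m" by (simp add: m_def)
  have "i \<le> M * (p * l / q\<^sup>2 + q * sqrt m)"
  proof (cases "l \<le> q ^ 4 * (1 - 1 / sqrt q)")
    case True
    have "i \<le> p * l / q\<^sup>2 + sqrt ((q\<^sup>2 + q) * (p * l * (1 - p / q ^ 3) * (1 - l / (q ^ 4 + q ^ 3 + q\<^sup>2))))"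
      using mix q by (simp add: power2_eq_square power3_eq_cube)
    also have "\<dots> \<le> p * l / q\<^sup>2 + sqrt (((1 + 1 / q) * (1 + 2 / sqrt q) * q)\<^sup>2 * m)"
      using max_0_radicand_le[OF q p l True] by (simp add: m_def)
    also have "\<dots> = p * l / q\<^sup>2 + (1 + 1 / q) * (1 + 2 / sqrt q) * (q * sqrt m)"
      using q by (simp add: real_sqrt_mult)
    also have "\<dots> \<le> M * (p * l / q\<^sup>2) + M * (q * sqrt m)"
      using M0 M1 p l q m0 mult_right_mono[of 1 M "p * l / q\<^sup>2"]
      by (intro add_mono mult_right_mono) auto
    finally show ?thesis by (simp add: distrib_left)
  next
    case False
    \<comment> \<open>The trivial bound is written with the threshold in the place of
      \<open>l\<close>, so that the larger \<open>l\<close> can be substituted. The root term is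
      nonnegative by truncation and is simply added.\<close>
    have "i \<le> (1 + 1 / q + 1 / q\<^sup>2) / (1 - 1 / sqrt q) * (p * (q ^ 4 * (1 - 1 / sqrt q)) / q\<^sup>2)"
    proof -
      have "p * (q\<^sup>2 + q + 1) = (1 + 1 / q + 1 / q\<^sup>2) * (p * q ^ 4 / q\<^sup>2)"
        using q by (simp add: field_simps power2_eq_square power4_eq_xxxx)
      also have "\<dots> = (1 + 1 / q + 1 / q\<^sup>2) / (1 - 1 / sqrt q) * (p * (q ^ 4 * (1 - 1 / sqrt q)) / q\<^sup>2)"
        using sq q by simp
      finally show ?thesis using triv by simp
    qed
    also have "\<dots> \<le> (1 + 1 / q + 1 / q\<^sup>2) / (1 - 1 / sqrt q) * (p * l / q\<^sup>2)"
      using False sq ge1 p q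
      by (intro mult_left_mono divide_right_mono) auto
    also have "\<dots> \<le> M * (p * l / q\<^sup>2 + q * sqrt m)"
      using M2 M0 p l q m0 by (intro mult_mono) auto
    finally show ?thesis .
  qed
  then show ?thesis unfolding M_def m_def incidence_bound_def .
qed

lemma incidences_lines3_le:
  fixes F :: "('a, 'm) ring_scheme"
  assumes "field F" "finite (carrier F)" "P \<subseteq> space3 F" "L \<subseteq> lines3 F"
  defines "q \<equiv> real (order F)"
  shows "real (incidences P L) \<le> (1 + 1 / q + 1 / q\<^sup>2) * (1 + 2 / sqrt q) / (1 - 1 / sqrt q)
    * incidence_bound q (real (card P)) (real (card L))"
proof -
  interpret field F by fact
  interpret S: steiner_system "space3 F" "lines3 F" "order F"
    by (rule steiner_system_lines3) fact
  have q: "q > 1" using order_gt_1 assms(2) by (simp add: q_def)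
  have v: "real (card (space3 F)) = q ^ 3" by (simp add: card_space3 q_def)
  \<comment> \<open>The degree and the number of lines follow by cancelling \<open>q - 1\<close>
    from \<open>q ^ 3 - 1\<close> and \<open>q\<close> from the incidence count.\<close>
  have "real S.r * (q - 1) = (q\<^sup>2 + q + 1) * (q - 1)"
    using S.r_mult unfolding v q_def[symmetric]
    by (simp add: algebra_simps power2_eq_square power3_eq_cube)
  then have r: "real S.r = q\<^sup>2 + q + 1" using q by simp
  have "real (card (lines3 F)) * q = (q ^ 4 + q ^ 3 + q\<^sup>2) * q"
    using arg_cong[OF S.card_B_mult, of real] unfolding of_nat_mult v r q_def[symmetric]
    by (simp add: algebra_simps power2_eq_square power3_eq_cube power4_eq_xxxx)
  then have b: "real (card (lines3 F)) = q ^ 4 + q ^ 3 + q\<^sup>2" using q by simp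
  have p: "real (card P) \<le> q ^ 3"
    using card_mono[OF S.finite_X assms(3)] v by linarith
  have triv: "real (incidences P L) \<le> real (card P) * (q\<^sup>2 + q + 1)"
    using S.incidences_le[OF assms(3,4)] r by (metis of_nat_le_iff of_nat_mult)
  show ?thesis
    using S.expander_mixing[OF assms(3,4)] unfolding v r b q_def[symmetric]
    by (intro le_incidence_bound q p triv) auto
qed

theorem theorem4:
  "\<exists>\<epsilon> :: nat \<Rightarrow> real. \<epsilon> \<longlonglongrightarrow> 0 \<and>
     (\<forall>(F :: 'a ring) P L.
        field F \<longrightarrow> finite (carrier F) \<longrightarrow> P \<subseteq> space3 F \<longrightarrow> L \<subseteq> lines3 F \<longrightarrow>
        real (incidences P L)
          \<le> (1 + \<epsilon> (order F)) * incidence_bound (real (order F)) (real (card P)) (real (card L)))"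
proof -
  \<comment> \<open>The explicit loss minus 1, fixed before \<open>F\<close>, \<open>P\<close> and
    \<open>L\<close>. Its values at 0 and 1, where a denominator vanishes, never occur, as a field
    has at least two elements.\<close>
  define \<epsilon> :: "nat \<Rightarrow> real" where "\<epsilon> = (\<lambda>n. (1 + 1 / real n + 1 / (real n)\<^sup>2)
    * (1 + 2 / sqrt (real n)) / (1 - 1 / sqrt (real n)) - 1)"
  have "\<epsilon> \<longlonglongrightarrow> 0" unfolding \<epsilon>_def by real_asymp
  then show ?thesis
    using incidences_lines3_le by (intro exI[of _ \<epsilon>]) (auto simp: \<epsilon>_def)
qed

end
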